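(* Consider the RDAG model on a coloured DAG $(\mathcal{G},c)$ where the colouring $c$ is compatible, and fix a sample matrix $Y\in\mathbb{R}^{m\times n}$. Then: (a) $\ell_Y$ is unbounded from above on the model if and only if $M_{Y,s}^{(0)}\in\mathrm{span}\{M_{Y,s}^{(i)} : i\in[\beta_s]\}$ for some $s\in c(I)$; (b) an MLE given $Y$ exists if and only if $M_{Y,s}^{(0)}\notin\mathrm{span}\{M_{Y,s}^{(i)} : i\in[\beta_s]\}$ for all $s\in c(I)$; (c) an MLE given $Y$ exists uniquely if and only if $M_{Y,s}$ has full row rank for all $s\in c(I)$.
   Context: $\mathcal{G}=(I,E)$ is a directed acyclic graph (DAG) with vertex set $I=[m]=\{1,\dots,m\}$ and edge set $E$ (no loops, no multiple edges); $j\to i$ denotes an edge from $j$ to $i$. Vertices are ordered so that $j\to i$ implies $j>i$. A coloured DAG $(\mathcal{G},c)$ is a DAG with a map $c: I\cup E\to \mathcal{C}$ to a set of colours; $c(i)$ is the colour of vertex $i$ and $c(ij)$ is the colour of the edge $j\to i$. The colouring $c$ is compatible if (i) vertex colours and edge colours are disjoint, and (ii) whenever edges $j\to i$ and $l\to k$ satisfy $c(ij)=c(kl)$, then $c(i)=c(k)$. The RDAG model on $(\mathcal{G},c)$ is the set of all matrices $\Psi=(\mathrm{id}-\Lambda)^{\mathsf T}\Omega^{-1}(\mathrm{id}-\Lambda)$, where $\Lambda\in\mathbb{R}^{m\times m}$ satisfies $\lambda_{ij}=0$ unless $j\to i$ in $\mathcal{G}$ and $\lambda_{ij}=\lambda_{kl}$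 whenever edges $j\to i$ and $l\to k$ have the same colour, and $\Omega\in\mathbb{R}^{m\times m}$ is diagonal with positive diagonal entries satisfying $\omega_{ii}=\omega_{jj}$ whenever vertices $i,j$ have the same colour. For a sample matrix $Y\in\mathbb{R}^{m\times n}$ ($n\ge 1$; columns are samples, $Y^{(i)}\in\mathbb{R}^{1\times n}$ is the $i$th row), the log-likelihood is $\ell_Y(\Psi)=\log\det(\Psi)-\mathrm{tr}(\Psi S_Y)$ with $S_Y=\frac1n YY^{\mathsf T}$. An MLE given $Y$ is a maximiser of $\ell_Y$ over the model. For a vertex colour $s\in c(I)$, let $\alpha_s$ be the number of vertices of colour $s$, $\mathrm{prc}(s)=\{c(ij)\mid j\to i \text{ in }\mathcal{G},\ c(i)=s\}$ (colours of edges whose target has colour $s$), and $\beta_s=|\mathrm{prc}(s)|$. Let $i_1<\dots<i_{\alpha_s}$ be the vertices of colour $s$. The augmented sample matrix $M_{Y,s}\in\mathbb{R}^{(\beta_s+1)\times\alpha_s n}$ has rows $M_{Y,s}^{(0)},\dots,M_{Y,s}^{(\beta_s)}$, each consisting of $\alpha_s$ blocks of length $n$: the top row is $M_{Y,s}^{(0)}=(Y^{(i_1)},\dots,Y^{(i_{\alpha_s})})$, and the other rows are indexed by the elements $t\in\mathrm{prc}(s)$ (identified with $[\beta_s]$ via a fixed enumeration), the row of $t$ having as its $k$th block $\sum_{j:\, j\to i_k,\ c(i_kj)=t} Y^{(j)}$ (zero if the sum is empty). *)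

theory Defs
  imports
    Complex_Main
    "Jordan_Normal_Form.DL_Rank"
    "Jordan_Normal_Form.Gauss_Jordan_Elimination"
begin

text \<open>
  Matrices and vectors are indexed from \<open>0\<close>, so the vertex set is \<open>{..<m}\<close>: the vertex written
  \<open>i \<in> {1..m}\<close> on paper is \<open>i - 1\<close> here, which preserves the vertex order.
  The pair \<open>(j, i)\<close> is the edge \<open>j \<rightarrow> i\<close>.
\<close>

definition ordered_dag :: "nat \<Rightarrow> (nat \<times> nat) set \<Rightarrow> bool" where
  "ordered_dag m E \<longleftrightarrow>
     E \<subseteq> {..<m} \<times> {..<m} \<and> acyclic E \<and> (\<forall>(j, i) \<in> E. i < j)"

text \<open>
  A colouring of vertices and edges is given by its two restrictions \<open>vc\<close> (vertices) and \<open>ec\<close>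
  (edges), with values in one and the same type of colours; \<open>c(ij)\<close> is \<open>ec (j, i)\<close>.
\<close>

definition compatible_colouring ::
  "nat \<Rightarrow> (nat \<times> nat) set \<Rightarrow> (nat \<Rightarrow> 'c) \<Rightarrow> (nat \<times> nat \<Rightarrow> 'c) \<Rightarrow> bool" where
  "compatible_colouring m E vc ec \<longleftrightarrow>
     vc ` {..<m} \<inter> ec ` E = {} \<and>
     (\<forall>(j, i) \<in> E. \<forall>(l, k) \<in> E. ec (j, i) = ec (l, k) \<longrightarrow> vc i = vc k)"

definition rdag_Lambda ::
  "nat \<Rightarrow> (nat \<times> nat) set \<Rightarrow> (nat \<times> nat \<Rightarrow> 'c) \<Rightarrow> real mat set" where
  "rdag_Lambda m E ec = {L \<in> carrier_mat m m.
     (\<forall>i < m. \<forall>j < m. (j, i) \<notin> E \<longrightarrow> L $$ (i, j) = 0) \<and>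
     (\<forall>(j, i) \<in> E. \<forall>(l, k) \<in> E. ec (j, i) = ec (l, k) \<longrightarrow> L $$ (i, j) = L $$ (k, l))}"

definition rdag_Omega :: "nat \<Rightarrow> (nat \<Rightarrow> 'c) \<Rightarrow> real mat set" where
  "rdag_Omega m vc = {W \<in> carrier_mat m m.
     diagonal_mat W \<and>
     (\<forall>i < m. 0 < W $$ (i, i)) \<and>
     (\<forall>i < m. \<forall>j < m. vc i = vc j \<longrightarrow> W $$ (i, i) = W $$ (j, j))}"

text \<open>Every matrix in \<^term>\<open>rdag_Omega m vc\<close> is invertible, so \<^const>\<open>mat_inverse\<close> yields
  \<^const>\<open>Some\<close> of its inverse.\<close>

definition rdag_model ::
  "nat \<Rightarrow> (nat \<times> nat) set \<Rightarrow> (nat \<Rightarrow> 'c) \<Rightarrow> (nat \<times> nat \<Rightarrow> 'c) \<Rightarrow> real mat set" where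
  "rdag_model m E vc ec =
     {transpose_mat (1\<^sub>m m - L) * the (mat_inverse W) * (1\<^sub>m m - L) | L W.
        L \<in> rdag_Lambda m E ec \<and> W \<in> rdag_Omega m vc}"

definition mat_trace :: "'a::comm_monoid_add mat \<Rightarrow> 'a" where
  "mat_trace A = (\<Sum>i < dim_row A. A $$ (i, i))"

definition sample_cov :: "real mat \<Rightarrow> real mat" where
  "sample_cov Y = (1 / real (dim_col Y)) \<cdot>\<^sub>m (Y * transpose_mat Y)"

definition log_likelihood :: "real mat \<Rightarrow> real mat \<Rightarrow> real" where
  "log_likelihood Y Psi = ln (det Psi) - mat_trace (Psi * sample_cov Y)"

definition is_MLE :: "real mat set \<Rightarrow> real mat \<Rightarrow> real mat \<Rightarrow> bool" where
  "is_MLE M Y Psi \<longleftrightarrow>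
     Psi \<in> M \<and> (\<forall>Phi \<in> M. log_likelihood Y Phi \<le> log_likelihood Y Psi)"

definition colour_vertices :: "nat \<Rightarrow> (nat \<Rightarrow> 'c) \<Rightarrow> 'c \<Rightarrow> nat set" where
  "colour_vertices m vc s = {i. i < m \<and> vc i = s}"

definition alpha :: "nat \<Rightarrow> (nat \<Rightarrow> 'c) \<Rightarrow> 'c \<Rightarrow> nat" where
  "alpha m vc s = card (colour_vertices m vc s)"

definition prc ::
  "(nat \<times> nat) set \<Rightarrow> (nat \<Rightarrow> 'c) \<Rightarrow> (nat \<times> nat \<Rightarrow> 'c) \<Rightarrow> 'c \<Rightarrow> 'c set" where
  "prc E vc ec s = {ec (j, i) | j i. (j, i) \<in> E \<and> vc i = s}"

definition beta ::
  "(nat \<times> nat) set \<Rightarrow> (nat \<Rightarrow> 'c) \<Rightarrow> (nat \<times> nat \<Rightarrow> 'c) \<Rightarrow> 'c \<Rightarrow> nat" where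
  "beta E vc ec s = card (prc E vc ec s)"

text \<open>\<open>enum s\<close> is the fixed enumeration of \<open>prc s\<close>, identifying it with \<open>{1..beta s}\<close>.\<close>

definition prc_enumeration ::
  "nat \<Rightarrow> (nat \<times> nat) set \<Rightarrow> (nat \<Rightarrow> 'c) \<Rightarrow> (nat \<times> nat \<Rightarrow> 'c) \<Rightarrow> ('c \<Rightarrow> nat \<Rightarrow> 'c) \<Rightarrow> bool" where
  "prc_enumeration m E vc ec enum \<longleftrightarrow>
     (\<forall>s \<in> vc ` {..<m}. bij_betw (enum s) {1..beta E vc ec s} (prc E vc ec s))"

text \<open>Column \<open>q\<close> is entry \<open>q mod n\<close> of block \<open>q div n\<close>, where \<open>n\<close> is the number of samples;
  \<open>i\<close> below is the vertex of colour \<open>s\<close> belonging to that block.\<close>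

definition augmented_sample_matrix ::
  "nat \<Rightarrow> (nat \<times> nat) set \<Rightarrow> (nat \<Rightarrow> 'c) \<Rightarrow> (nat \<times> nat \<Rightarrow> 'c) \<Rightarrow> ('c \<Rightarrow> nat \<Rightarrow> 'c) \<Rightarrow>
   real mat \<Rightarrow> 'c \<Rightarrow> real mat" where
  "augmented_sample_matrix m E vc ec enum Y s =
     (let n = dim_col Y in
      mat (beta E vc ec s + 1) (alpha m vc s * n) (\<lambda>(r, q).
        let i = sorted_list_of_set (colour_vertices m vc s) ! (q div n) in
        if r = 0 then Y $$ (i, q mod n)
        else (\<Sum>j | (j, i) \<in> E \<and> ec (j, i) = enum s r. Y $$ (j, q mod n))))"

definition top_row_in_span :: "real mat \<Rightarrow> bool" where
  "top_row_in_span A \<longleftrightarrow>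
     row A 0 \<in> LinearCombinations.module.span class_ring (module_vec TYPE(real) (dim_col A))
                 {row A r | r. 1 \<le> r \<and> r < dim_row A}"

text \<open>\<^const>\<open>vec_space.rank\<close> takes the dimension of the ambient space of the columns as its
  first argument.\<close>

definition full_row_rank :: "real mat \<Rightarrow> bool" where
  "full_row_rank A \<longleftrightarrow> vec_space.rank (dim_row A) A = dim_row A"

end

theory Submission
  imports Defs
begin

text \<open>
  Write \<open>\<Lambda>\<close> in terms of a real parameter \<open>a t\<close> for each edge colour \<open>t\<close>, and \<open>\<Omega>\<close> in terms of a
  positive \<open>w s\<close> for each vertex colour \<open>s\<close>. As \<open>id - \<Lambda>\<close> is unit upper triangular, the determinant
  of the concentration matrix is the product of the \<open>1 / w (vc i)\<close>, and the trace is a weighted sum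
  of squared residuals of each sample row against its parents. Collecting vertices by colour, the
  log-likelihood is the sum over the vertex colours \<open>s\<close> of
  \<open>- \<alpha>\<^sub>s * ln (w s) - rss a s / (n * w s)\<close>, where \<open>rss a s\<close> is the squared distance of the top row
  of the augmented sample matrix from the combination of its other rows with coefficients \<open>a\<close>
  (\<open>log_likelihood_concentration\<close>).

  If the top row of some colour lies in the span of the others, some \<open>a\<close> makes \<open>rss a s\<close> vanish,
  and letting \<open>w s\<close> tend to \<open>0\<close> makes the likelihood unbounded (\<open>unbounded_if_perfect_fit\<close>).
  Otherwise, compatibility makes the sets \<open>prc s\<close> disjoint, so a single \<open>a\<close> solves all the least
  squares problems (\<open>ex_least_squares\<close>); then all minimal \<open>rss a s\<close> are positive, and each summand
  is greatest at \<open>w s = rss a s / (n * \<alpha>\<^sub>s)\<close> and nowhere else (\<open>scaled_log_bound\<close>). This gives an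
  estimate.

  Every other estimate attains the same minimal residuals and the same variances, so by
  Pythagoras its \<open>a\<close> differs by a relation among the lower rows; these relations are trivial under
  full row rank. Conversely, a nontrivial relation moves \<open>a\<close> without changing the likelihood, and
  the concentration matrix changes with it, because its triangular factor is unique
  (\<open>concentration_inj\<close>).

  The algebraic input is the solvability of the normal equations. It provides the least squares
  solutions, and also the identification of full row rank, which is defined by the dimension of
  the column space, with linear independence of the rows (\<open>full_row_rank_iff\<close>).
\<close>

section \<open>Least squares\<close>

text \<open>The induction adds a regressor \<open>u t0\<close> by replacing it with its residual \<open>p\<close> against the
  others and correcting the fit along \<open>p\<close>, as in the Gram-Schmidt process. Linear independence is
  not needed.\<close>

lemma normal_equations_solvable:
  fixes u :: "'t \<Rightarrow> 'q \<Rightarrow> real" and v :: "'q \<Rightarrow> real"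
  assumes "finite T" "finite Q"
  shows "\<exists>a. \<forall>t\<in>T. (\<Sum>q\<in>Q. (v q - (\<Sum>s\<in>T. a s * u s q)) * u t q) = 0"
  using assms(1)
proof (induction T arbitrary: v rule: finite_induct)
  case empty
  show ?case by simp
next
  case (insert t0 T)
  obtain b where b: "\<forall>t\<in>T. (\<Sum>q\<in>Q. (u t0 q - (\<Sum>s\<in>T. b s * u s q)) * u t q) = 0"
    using insert.IH by blast
  define p where "p q = u t0 q - (\<Sum>s\<in>T. b s * u s q)" for q
  obtain a where a: "\<forall>t\<in>T. (\<Sum>q\<in>Q. (v q - (\<Sum>s\<in>T. a s * u s q)) * u t q) = 0"
    using insert.IH by blast
  define r where "r q = v q - (\<Sum>s\<in>T. a s * u s q)" for q
  \<comment> \<open>If \<open>p\<close> vanishes on \<open>Q\<close>, the denominator is \<open>0\<close>, and any value of \<open>c\<close> would do.\<close>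
  define c where "c = (\<Sum>q\<in>Q. r q * p q) / (\<Sum>q\<in>Q. p q * p q)"
  have rp: "(\<Sum>q\<in>Q. (r q - c * p q) * p q) = 0"
  proof (cases "(\<Sum>q\<in>Q. p q * p q) = 0")
    case True
    then have "\<forall>q\<in>Q. p q = 0"
      using assms(2) by (subst (asm) sum_nonneg_eq_0_iff) auto
    then show ?thesis by simp
  next
    case False
    have "(\<Sum>q\<in>Q. (r q - c * p q) * p q) = (\<Sum>q\<in>Q. r q * p q) - c * (\<Sum>q\<in>Q. p q * p q)"
      by (simp add: left_diff_distrib sum_subtractf sum_distrib_left mult.assoc)
    then show ?thesis using False by (simp add: c_def)
  qed
  have orth: "(\<Sum>q\<in>Q. (r q - c * p q) * u t q) = 0" if "t \<in> T" for t
  proof -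
    have "(\<Sum>q\<in>Q. (r q - c * p q) * u t q)
        = (\<Sum>q\<in>Q. r q * u t q) - c * (\<Sum>q\<in>Q. p q * u t q)"
      by (simp add: left_diff_distrib sum_subtractf sum_distrib_left mult.assoc)
    then show ?thesis using a b that by (simp add: r_def p_def)
  qed
  have "(\<Sum>q\<in>Q. (r q - c * p q) * u t0 q)
      = (\<Sum>q\<in>Q. (r q - c * p q) * (p q + (\<Sum>s\<in>T. b s * u s q)))"
    by (simp add: p_def)
  also have "\<dots> = (\<Sum>q\<in>Q. (r q - c * p q) * p q)
      + (\<Sum>q\<in>Q. \<Sum>s\<in>T. b s * ((r q - c * p q) * u s q))"
    by (simp add: distrib_left sum.distrib sum_distrib_left mult_ac)
  also have "(\<Sum>q\<in>Q. \<Sum>s\<in>T. b s * ((r q - c * p q) * u s q))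
      = (\<Sum>s\<in>T. b s * (\<Sum>q\<in>Q. (r q - c * p q) * u s q))"
    by (subst sum.swap) (simp add: sum_distrib_left)
  finally have orth0: "(\<Sum>q\<in>Q. (r q - c * p q) * u t0 q) = 0"
    using rp orth by simp
  define a' where "a' s = (if s = t0 then c else a s - c * b s)" for s
  have "v q - (\<Sum>s\<in>insert t0 T. a' s * u s q) = r q - c * p q" for q
  proof -
    have "(\<Sum>s\<in>T. a' s * u s q) = (\<Sum>s\<in>T. (a s - c * b s) * u s q)"
      using insert.hyps by (intro sum.cong) (auto simp: a'_def)
    also have "\<dots> = (\<Sum>s\<in>T. a s * u s q) - c * (\<Sum>s\<in>T. b s * u s q)"
      by (simp add: left_diff_distrib sum_subtractf sum_distrib_left mult.assoc)
    finally show ?thesis using insert.hyps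
      by (simp add: r_def p_def a'_def right_diff_distrib)
  qed
  then have "\<forall>t\<in>insert t0 T. (\<Sum>q\<in>Q. (v q - (\<Sum>s\<in>insert t0 T. a' s * u s q)) * u t q) = 0"
    using orth orth0 by simp
  then show ?case by blast
qed

section \<open>The optimal variance\<close>

text \<open>One summand of the likelihood: \<open>\<alpha>\<close> vertices, \<open>N\<close> samples, residual sum of squares \<open>R\<close> with
  least value \<open>R0\<close>, and variance \<open>w\<close>. It is greatest for \<open>R = R0\<close> and \<open>w = w0\<close> only, by
  \<open>ln x \<le> x - 1\<close> at \<open>x = w0 / w\<close>.\<close>

lemma scaled_log_bound:
  fixes \<alpha> R R0 N w w0 :: real
  assumes "0 < \<alpha>" "0 < N" "0 < R0" "R0 \<le> R" "0 < w" and w0: "w0 = R0 / (N * \<alpha>)"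
  shows "- \<alpha> * ln w - R / (N * w) \<le> - \<alpha> * ln w0 - R0 / (N * w0)"
    and "- \<alpha> * ln w - R / (N * w) = - \<alpha> * ln w0 - R0 / (N * w0) \<Longrightarrow> R = R0 \<and> w = w0"
proof -
  have w0_pos: "0 < w0" unfolding w0 using assms(1-3) by simp
  have at_w0: "R0 / (N * w0) = \<alpha>" unfolding w0 using assms(1-3) by simp
  have at_w: "R0 / (N * w) = \<alpha> * (w0 / w)" unfolding w0 using assms(1-3) by simp
  have R: "R0 / (N * w) \<le> R / (N * w)" using assms(2,4,5) by (simp add: divide_right_mono)
  have ln_le: "ln (w0 / w) \<le> w0 / w - 1"
    using ln_le_minus_one[of "w0 / w"] w0_pos assms(5) by simp
  have ln_le': "\<alpha> * ln (w0 / w) \<le> \<alpha> * (w0 / w) - \<alpha>"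
    using mult_left_mono[OF ln_le, of \<alpha>] assms(1) by (simp add: right_diff_distrib)
  have "\<alpha> * ln (w0 / w) = \<alpha> * (ln w0 - ln w)"
    using w0_pos assms(5) by (simp add: ln_div)
  then have ln_quot: "\<alpha> * ln (w0 / w) = \<alpha> * ln w0 - \<alpha> * ln w"
    by (simp only: right_diff_distrib)
  show "- \<alpha> * ln w - R / (N * w) \<le> - \<alpha> * ln w0 - R0 / (N * w0)"
    using R ln_le' at_w at_w0 ln_quot by linarith
  assume eq: "- \<alpha> * ln w - R / (N * w) = - \<alpha> * ln w0 - R0 / (N * w0)"
  have "\<alpha> * ln (w0 / w) = \<alpha> * (w0 / w) - \<alpha>" and RR: "R0 / (N * w) = R / (N * w)"
    using R ln_le' at_w at_w0 ln_quot eq by linarith+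
  then have "\<alpha> * ln (w0 / w) = \<alpha> * (w0 / w - 1)" by (simp only: right_diff_distrib mult_1_right)
  then have "ln (w0 / w) = w0 / w - 1" using assms(1) by simp
  then have "w0 / w = 1" using ln_eq_minus_one[of "w0 / w"] w0_pos assms(5) by simp
  then have "w = w0" using assms(5) by (simp add: field_simps)
  moreover have "R = R0" using RR assms(2,5) by simp
  ultimately show "R = R0 \<and> w = w0" by simp
qed

section \<open>Row span and row rank in coordinates\<close>

lemma top_row_in_span_iff:
  assumes "0 < dim_row A"
  shows "top_row_in_span A \<longleftrightarrow>
    (\<exists>c. \<forall>q<dim_col A. A $$ (0, q) = (\<Sum>r = 1..<dim_row A. c r * A $$ (r, q)))"
proof -
  interpret vec_space "TYPE(real)" "dim_col A" .
  define B where "B = mat (dim_col A) (dim_row A - 1) (\<lambda>(q, r). A $$ (Suc r, q))"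
  have B: "B \<in> carrier_mat (dim_col A) (dim_row A - 1)" by (simp add: B_def)
  have "{row A r | r. 1 \<le> r \<and> r < dim_row A} = (\<lambda>r. row A (Suc r)) ` {..<dim_row A - 1}"
  proof (intro equalityI subsetI)
    fix x assume "x \<in> {row A r | r. 1 \<le> r \<and> r < dim_row A}"
    then obtain r where "x = row A r" "1 \<le> r" "r < dim_row A" by blast
    then show "x \<in> (\<lambda>r. row A (Suc r)) ` {..<dim_row A - 1}"
      by (intro image_eqI[of _ _ "r - 1"]) auto
  qed auto
  also have "\<dots> = (\<lambda>r. col B r) ` {..<dim_row A - 1}"
    by (intro image_cong) (auto simp: B_def)
  also have "\<dots> = set (cols B)"
    using B by (auto simp: cols_def)
  finally have rows: "{row A r | r. 1 \<le> r \<and> r < dim_row A} = set (cols B)" .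
  have Bv: "(B *\<^sub>v x) $ q = (\<Sum>r = 1..<dim_row A. x $ (r - 1) * A $$ (r, q))"
    if "x \<in> carrier_vec (dim_row A - 1)" "q < dim_col A" for x q
  proof -
    have "(B *\<^sub>v x) $ q = (\<Sum>r = 0..<dim_row A - 1. A $$ (Suc r, q) * x $ r)"
      using that by (simp add: B_def scalar_prod_def)
    also have "\<dots> = (\<Sum>r = Suc 0..<Suc (dim_row A - 1). A $$ (r, q) * x $ (r - 1))"
      by (subst sum.shift_bounds_Suc_ivl) simp
    finally show ?thesis using assms by (simp add: mult.commute)
  qed
  have "top_row_in_span A \<longleftrightarrow> row A 0 \<in> col_space B"
    unfolding top_row_in_span_def rows col_space_def ..
  also have "\<dots> \<longleftrightarrow> (\<exists>x\<in>carrier_vec (dim_row A - 1). B *\<^sub>v x = row A 0)"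
    unfolding col_space_eq[OF B] using B by auto
  also have "\<dots> \<longleftrightarrow> (\<exists>c. \<forall>q<dim_col A. A $$ (0, q) = (\<Sum>r = 1..<dim_row A. c r * A $$ (r, q)))"
  proof
    assume "\<exists>x\<in>carrier_vec (dim_row A - 1). B *\<^sub>v x = row A 0"
    then obtain x where x: "x \<in> carrier_vec (dim_row A - 1)" "B *\<^sub>v x = row A 0" by blast
    show "\<exists>c. \<forall>q<dim_col A. A $$ (0, q) = (\<Sum>r = 1..<dim_row A. c r * A $$ (r, q))"
    proof (intro exI[of _ "\<lambda>r. x $ (r - 1)"] allI impI)
      fix q assume q: "q < dim_col A"
      show "A $$ (0, q) = (\<Sum>r = 1..<dim_row A. x $ (r - 1) * A $$ (r, q))"
        unfolding Bv[OF x(1) q, symmetric] x(2) using q assms by simp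
    qed
  next
    assume "\<exists>c. \<forall>q<dim_col A. A $$ (0, q) = (\<Sum>r = 1..<dim_row A. c r * A $$ (r, q))"
    then obtain c where c: "\<And>q. q < dim_col A \<Longrightarrow>
      A $$ (0, q) = (\<Sum>r = 1..<dim_row A. c r * A $$ (r, q))" by blast
    define x where "x = vec (dim_row A - 1) (\<lambda>r. c (Suc r))"
    have x: "x \<in> carrier_vec (dim_row A - 1)" by (simp add: x_def)
    have "B *\<^sub>v x = row A 0"
    proof (rule eq_vecI)
      fix q assume "q < dim_vec (row A 0)"
      then have q: "q < dim_col A" by simp
      have "(B *\<^sub>v x) $ q = (\<Sum>r = 1..<dim_row A. c r * A $$ (r, q))"
        unfolding Bv[OF x q] by (intro sum.cong) (auto simp: x_def)
      then show "(B *\<^sub>v x) $ q = row A 0 $ q" using c[OF q] q assms by simp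
    qed (simp add: B_def)
    then show "\<exists>x\<in>carrier_vec (dim_row A - 1). B *\<^sub>v x = row A 0" using x by blast
  qed
  finally show ?thesis .
qed

lemma full_row_rank_iff_col_space:
  fixes A :: "real mat"
  shows "full_row_rank A \<longleftrightarrow>
    (\<forall>v\<in>carrier_vec (dim_row A). \<exists>x\<in>carrier_vec (dim_col A). A *\<^sub>v x = v)"
proof -
  interpret vec_space "TYPE(real)" "dim_row A" .
  have A: "A \<in> carrier_mat (dim_row A) (dim_col A)" by simp
  have cols: "set (cols A) \<subseteq> carrier_vec (dim_row A)" using cols_dim[of A] .
  have "rank A = dim_row A \<longleftrightarrow> span (set (cols A)) = carrier_vec (dim_row A)"
  proof
    assume full: "rank A = dim_row A"
    obtain S where S: "maximal S (\<lambda>T. T \<subseteq> set (cols A) \<and> lin_indpt T)"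
      using maximal_exists[of "(\<lambda>T. T \<subseteq> set (cols A) \<and> lin_indpt T)" "card (set (cols A))" "{}"]
      by (meson List.finite_set card_mono empty_iff empty_subsetI finite_lin_indpt2 rev_finite_subset)
    then have sub: "S \<subseteq> set (cols A)" and indpt: "lin_indpt S" by (auto simp: maximal_def)
    have "card S = dim" using rank_card_indpt[OF A S] full dim_is_n by simp
    then have "basis S"
      using indpt order_trans[OF sub cols] finite_subset[OF sub]
      by (intro dim_li_is_basis) simp_all
    then have "carrier_vec (dim_row A) \<subseteq> span (set (cols A))"
      using span_is_monotone[OF sub] by (auto simp: basis_def)
    then show "span (set (cols A)) = carrier_vec (dim_row A)"
      using span_is_subset2[of "set (cols A)"] cols by auto
  next
    assume "span (set (cols A)) = carrier_vec (dim_row A)"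
    then show "rank A = dim_row A"
      unfolding rank_def using dim_is_n by (simp add: module_vec_def)
  qed
  also have "\<dots> \<longleftrightarrow> (\<forall>v\<in>carrier_vec (dim_row A). \<exists>x\<in>carrier_vec (dim_col A). A *\<^sub>v x = v)"
    unfolding col_space_def[symmetric] col_space_eq[OF A] by auto
  finally show ?thesis unfolding full_row_rank_def .
qed

text \<open>Full row rank, defined through the span of the columns, is linear independence of the rows.\<close>

lemma full_row_rank_iff:
  fixes A :: "real mat"
  shows "full_row_rank A \<longleftrightarrow>
    (\<forall>c. (\<forall>q<dim_col A. (\<Sum>r<dim_row A. c r * A $$ (r, q)) = 0) \<longrightarrow> (\<forall>r<dim_row A. c r = 0))"
    (is "_ \<longleftrightarrow> ?indep")
proof
  assume full: "full_row_rank A"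
  show ?indep
  proof (intro allI impI)
    fix c r assume c: "\<forall>q<dim_col A. (\<Sum>r<dim_row A. c r * A $$ (r, q)) = 0" and r: "r < dim_row A"
    obtain x where x: "x \<in> carrier_vec (dim_col A)" "A *\<^sub>v x = vec (dim_row A) c"
      using full[unfolded full_row_rank_iff_col_space, rule_format, of "vec (dim_row A) c"] by auto
    have "c i * c i = (\<Sum>q<dim_col A. x $ q * (c i * A $$ (i, q)))" if "i < dim_row A" for i
    proof -
      have "c i = (A *\<^sub>v x) $ i" using x(2) that by simp
      also have "\<dots> = (\<Sum>q<dim_col A. A $$ (i, q) * x $ q)"
        using x(1) that by (simp add: scalar_prod_def atLeast0LessThan)
      finally have "c i * c i = c i * (\<Sum>q<dim_col A. A $$ (i, q) * x $ q)" by (rule arg_cong)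
      then show ?thesis by (simp only: sum_distrib_left mult_ac)
    qed
    then have "(\<Sum>i<dim_row A. c i * c i)
        = (\<Sum>i<dim_row A. \<Sum>q<dim_col A. x $ q * (c i * A $$ (i, q)))"
      by (intro sum.cong) simp_all
    also have "\<dots> = (\<Sum>q<dim_col A. x $ q * (\<Sum>i<dim_row A. c i * A $$ (i, q)))"
      by (subst sum.swap) (simp add: sum_distrib_left)
    also have "\<dots> = 0" using c by simp
    finally show "c r = 0"
      using r by (subst (asm) sum_nonneg_eq_0_iff) auto
  qed
next
  assume indep: ?indep
  show "full_row_rank A"
    unfolding full_row_rank_iff_col_space
  proof
    fix v :: "real vec" assume v: "v \<in> carrier_vec (dim_row A)"
    \<comment> \<open>The residual of \<open>v\<close> against the columns is a linear relation among the rows.\<close>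
    obtain a where a: "\<forall>t\<in>{..<dim_col A}. (\<Sum>i<dim_row A.
        (v $ i - (\<Sum>s<dim_col A. a s * A $$ (i, s))) * A $$ (i, t)) = 0"
      using normal_equations_solvable[of "{..<dim_col A}" "{..<dim_row A}" "\<lambda>i. v $ i"
          "\<lambda>t i. A $$ (i, t)"] by auto
    define r where "r i = v $ i - (\<Sum>s<dim_col A. a s * A $$ (i, s))" for i
    have "\<forall>q<dim_col A. (\<Sum>i<dim_row A. r i * A $$ (i, q)) = 0"
      using a unfolding r_def by blast
    then have r: "\<forall>i<dim_row A. r i = 0" using indep by blast
    have "A *\<^sub>v vec (dim_col A) a = v"
    proof (rule eq_vecI)
      fix i assume "i < dim_vec v"
      then have i: "i < dim_row A" using v by simp
      have "(A *\<^sub>v vec (dim_col A) a) $ i = (\<Sum>s<dim_col A. a s * A $$ (i, s))"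
        using i by (simp add: scalar_prod_def atLeast0LessThan mult.commute)
      also have "\<dots> = v $ i" using r i by (simp add: r_def)
      finally show "(A *\<^sub>v vec (dim_col A) a) $ i = v $ i" .
    qed (use v in simp)
    then show "\<exists>x\<in>carrier_vec (dim_col A). A *\<^sub>v x = v"
      by (intro bexI[of _ "vec (dim_col A) a"]) simp_all
  qed
qed

section \<open>Parametrisation of the model\<close>

lemma mat_inverse_mat_diag:
  fixes d :: "nat \<Rightarrow> 'a :: field"
  assumes "\<And>i. i < m \<Longrightarrow> d i \<noteq> 0"
  shows "mat_inverse (mat_diag m d) = Some (mat_diag m (\<lambda>i. 1 / d i))"
proof -
  let ?D = "mat_diag m d" and ?D' = "mat_diag m (\<lambda>i. 1 / d i)"
  have DD': "?D * ?D' = 1\<^sub>m m" "?D' * ?D = 1\<^sub>m m"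
    using assms by (simp_all, auto simp: mat_diag_def)
  have "mat_inverse ?D \<noteq> None"
  proof
    assume "mat_inverse ?D = None"
    then have "?D \<notin> Units (ring_mat TYPE('a) m ())"
      using mat_inverse(1)[of ?D m] by simp
    moreover have "?D \<in> Units (ring_mat TYPE('a) m ())"
      unfolding Units_def using DD' by (auto simp: ring_mat_simps simp del: mat_diag_diag)
    ultimately show False by blast
  qed
  then obtain B where B: "mat_inverse ?D = Some B" by blast
  then have inv: "B * ?D = 1\<^sub>m m" "B \<in> carrier_mat m m"
    using mat_inverse(2)[of ?D m B] by auto
  have "B = B * (?D * ?D')" using inv DD' by simp
  also have "\<dots> = (B * ?D) * ?D'"
    using inv(2) by (simp add: assoc_mult_mat[of _ m m _ m _ m])
  also have "\<dots> = ?D'" unfolding inv(1) by (rule left_mult_one_mat[OF mat_diag_dim])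
  finally show ?thesis using B by simp
qed

text \<open>\<open>edge_mat m E ec a\<close> is the matrix \<open>\<Lambda>\<close> whose entry at the edge \<open>j \<rightarrow> i\<close> is the value of \<open>a\<close> at
  the colour of that edge.\<close>

definition edge_mat :: "nat \<Rightarrow> (nat \<times> nat) set \<Rightarrow> (nat \<times> nat \<Rightarrow> 'c) \<Rightarrow> ('c \<Rightarrow> real) \<Rightarrow> real mat" where
  "edge_mat m E ec a = mat m m (\<lambda>(i, j). if (j, i) \<in> E then a (ec (j, i)) else 0)"

text \<open>The concentration matrix with edge parameters \<open>a\<close> and variances \<open>w\<close>, both indexed by
  colours.\<close>

definition concentration ::
  "nat \<Rightarrow> (nat \<times> nat) set \<Rightarrow> (nat \<Rightarrow> 'c) \<Rightarrow> (nat \<times> nat \<Rightarrow> 'c) \<Rightarrow> ('c \<Rightarrow> real) \<Rightarrow> ('c \<Rightarrow> real) \<Rightarrow> real mat"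
  where
  "concentration m E vc ec a w =
     transpose_mat (1\<^sub>m m - edge_mat m E ec a) * mat_diag m (\<lambda>i. 1 / w (vc i))
       * (1\<^sub>m m - edge_mat m E ec a)"

lemma rdag_Lambda_eq:
  assumes "ordered_dag m E"
  shows "rdag_Lambda m E ec = range (edge_mat m E ec)"
proof (intro equalityI subsetI)
  fix L assume L: "L \<in> rdag_Lambda m E ec"
  \<comment> \<open>\<open>L\<close> is constant on each edge colour, so its value at any representative edge serves.\<close>
  define pick where "pick t = (SOME e. e \<in> E \<and> ec e = t)" for t
  define a where "a t = L $$ (snd (pick t), fst (pick t))" for t
  have "a (ec (j, i)) = L $$ (i, j)" if e: "(j, i) \<in> E" for i j
  proof -
    obtain l k where lk: "pick (ec (j, i)) = (l, k)" by fastforce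
    then have "(l, k) \<in> E" "ec (l, k) = ec (j, i)"
      using someI[of "\<lambda>x. x \<in> E \<and> ec x = ec (j, i)" "(j, i)"] e by (auto simp: pick_def)
    then show ?thesis using L e lk by (fastforce simp: rdag_Lambda_def a_def)
  qed
  then have "L = edge_mat m E ec a"
    using L by (intro eq_matI) (auto simp: edge_mat_def rdag_Lambda_def)
  then show "L \<in> range (edge_mat m E ec)" by blast
next
  fix L assume "L \<in> range (edge_mat m E ec)"
  moreover have "E \<subseteq> {..<m} \<times> {..<m}" using assms by (simp add: ordered_dag_def)
  ultimately show "L \<in> rdag_Lambda m E ec"
    by (auto simp: rdag_Lambda_def edge_mat_def subset_iff)
qed

lemma rdag_Omega_eq:
  "rdag_Omega m vc = {mat_diag m (\<lambda>i. w (vc i)) | w. \<forall>s. 0 < w s}"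
proof (intro equalityI subsetI)
  fix W assume W: "W \<in> rdag_Omega m vc"
  then have dims: "W \<in> carrier_mat m m" and diag: "diagonal_mat W"
    and pos: "\<And>i. i < m \<Longrightarrow> 0 < W $$ (i, i)"
    unfolding rdag_Omega_def by blast+
  define pick where "pick s = (SOME i. i < m \<and> vc i = s)" for s
  \<comment> \<open>The value \<open>1\<close> at unused colours keeps \<open>w\<close> positive everywhere.\<close>
  define w where "w s = (if s \<in> vc ` {..<m} then W $$ (pick s, pick s) else 1)" for s
  have pick: "pick s < m \<and> vc (pick s) = s" if "s \<in> vc ` {..<m}" for s
    unfolding pick_def by (rule someI_ex) (use that in auto)
  have "w (vc i) = W $$ (i, i)" if "i < m" for i
  proof -
    have "pick (vc i) < m" "vc (pick (vc i)) = vc i" using pick[of "vc i"] that by auto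
    then have "W $$ (pick (vc i), pick (vc i)) = W $$ (i, i)"
      using W that unfolding rdag_Omega_def by blast
    then show ?thesis using that by (simp add: w_def)
  qed
  then have "W = mat_diag m (\<lambda>i. w (vc i))"
    using dims diag by (intro eq_matI) (auto simp: mat_diag_def diagonal_mat_def)
  moreover have "0 < w s" for s
    using pos pick[of s] by (simp add: w_def)
  ultimately show "W \<in> {mat_diag m (\<lambda>i. w (vc i)) | w. \<forall>s. 0 < w s}" by blast
qed (auto simp: rdag_Omega_def mat_diag_def diagonal_mat_def)

lemma rdag_model_eq:
  assumes "ordered_dag m E"
  shows "rdag_model m E vc ec = {concentration m E vc ec a w | a w. \<forall>s. 0 < w s}"
proof -
  have inv: "the (mat_inverse (mat_diag m (\<lambda>i. w (vc i)))) = mat_diag m (\<lambda>i. 1 / w (vc i))"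
    if "\<forall>s. 0 < w s" for w :: "'a \<Rightarrow> real"
    using that by (subst mat_inverse_mat_diag) (auto simp: less_imp_neq[symmetric])
  show ?thesis
    unfolding rdag_model_def rdag_Lambda_eq[OF assms] rdag_Omega_eq
  proof (intro equalityI subsetI)
    fix Psi assume "Psi \<in> {concentration m E vc ec a w | a w. \<forall>s. 0 < w s}"
    then obtain a w where w: "\<forall>s. 0 < w s" and Psi: "Psi = concentration m E vc ec a w" by blast
    show "Psi \<in> {transpose_mat (1\<^sub>m m - L) * the (mat_inverse W) * (1\<^sub>m m - L) | L W.
        L \<in> range (edge_mat m E ec) \<and> W \<in> {mat_diag m (\<lambda>i. w (vc i)) | w. \<forall>s. 0 < w s}}"
      unfolding Psi concentration_def inv[OF w, symmetric] using w by blast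
  next
    fix Psi assume "Psi \<in> {transpose_mat (1\<^sub>m m - L) * the (mat_inverse W) * (1\<^sub>m m - L) | L W.
        L \<in> range (edge_mat m E ec) \<and> W \<in> {mat_diag m (\<lambda>i. w (vc i)) | w. \<forall>s. 0 < w s}}"
    then obtain a w where w: "\<forall>s. 0 < w s"
      and Psi: "Psi = transpose_mat (1\<^sub>m m - edge_mat m E ec a)
        * the (mat_inverse (mat_diag m (\<lambda>i. w (vc i)))) * (1\<^sub>m m - edge_mat m E ec a)" by blast
    then have "Psi = concentration m E vc ec a w"
      unfolding concentration_def inv[OF w] by simp
    then show "Psi \<in> {concentration m E vc ec a w | a w. \<forall>s. 0 < w s}" using w by blast
  qed
qed

text \<open>A factorisation \<open>U\<^sup>T D U\<close> with \<open>U\<close> unit upper triangular and \<open>D\<close> diagonal is unique; only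
  the case of a common \<open>D\<close> is needed.\<close>

lemma unit_upper_triangular_factor_unique:
  fixes U V :: "'a :: field mat"
  assumes U: "U \<in> carrier_mat m m" "upper_triangular U" "\<And>i. i < m \<Longrightarrow> U $$ (i, i) = 1"
    and V: "V \<in> carrier_mat m m" "upper_triangular V" "\<And>i. i < m \<Longrightarrow> V $$ (i, i) = 1"
    and d: "\<And>i. i < m \<Longrightarrow> d i \<noteq> 0"
    and eq: "transpose_mat U * mat_diag m d * U = transpose_mat V * mat_diag m d * V"
  shows "U = V"
proof -
  have entry: "(transpose_mat X * mat_diag m d * X) $$ (j, k)
      = (\<Sum>i<j. X $$ (i, j) * d i * X $$ (i, k)) + d j * X $$ (j, k)"
    if X: "X \<in> carrier_mat m m" "upper_triangular X" "\<And>i. i < m \<Longrightarrow> X $$ (i, i) = 1"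
      and jk: "j < m" "k < m" for X j k
  proof -
    have "(transpose_mat X * mat_diag m d * X) $$ (j, k)
        = (\<Sum>i<m. X $$ (i, j) * d i * X $$ (i, k))"
      using X(1) jk
      by (simp add: mat_diag_mult_right[of _ m] scalar_prod_def atLeast0LessThan)
    also have "\<dots> = (\<Sum>i<Suc j. X $$ (i, j) * d i * X $$ (i, k))"
      using X jk by (intro sum.mono_neutral_right) (auto simp: not_less upper_triangularD)
    finally show ?thesis using X(3) jk by simp
  qed
  have "\<forall>k<m. U $$ (j, k) = V $$ (j, k)" if "j < m" for j
    using that
  proof (induction j rule: less_induct)
    case (less j)
    have "d j * U $$ (j, k) = d j * V $$ (j, k)" if "k < m" for k
    proof -
      have "(\<Sum>i<j. U $$ (i, j) * d i * U $$ (i, k)) = (\<Sum>i<j. V $$ (i, j) * d i * V $$ (i, k))"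
        using less that by (intro sum.cong) auto
      moreover have "(\<Sum>i<j. U $$ (i, j) * d i * U $$ (i, k)) + d j * U $$ (j, k)
          = (\<Sum>i<j. V $$ (i, j) * d i * V $$ (i, k)) + d j * V $$ (j, k)"
      proof -
        have "(\<Sum>i<j. U $$ (i, j) * d i * U $$ (i, k)) + d j * U $$ (j, k)
            = (transpose_mat U * mat_diag m d * U) $$ (j, k)"
          by (rule entry[OF U less.prems that, symmetric])
        also have "\<dots> = (transpose_mat V * mat_diag m d * V) $$ (j, k)"
          by (simp only: eq)
        also have "\<dots> = (\<Sum>i<j. V $$ (i, j) * d i * V $$ (i, k)) + d j * V $$ (j, k)"
          by (rule entry[OF V less.prems that])
        finally show ?thesis .
      qed
      ultimately show ?thesis by (simp only: add_left_cancel)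
    qed
    then show ?case using d less.prems by simp
  qed
  then show ?thesis using U V by (intro eq_matI) auto
qed

context
  fixes m :: nat and E :: "(nat \<times> nat) set" and ec :: "nat \<times> nat \<Rightarrow> 'c"
  assumes dag: "ordered_dag m E"
begin

lemma edgeD: "(j, i) \<in> E \<Longrightarrow> i < j \<and> j < m"
  using dag by (auto simp: ordered_dag_def)

lemma unit_edge_mat:
  shows "1\<^sub>m m - edge_mat m E ec a \<in> carrier_mat m m"
    and "upper_triangular (1\<^sub>m m - edge_mat m E ec a)"
    and "i < m \<Longrightarrow> (1\<^sub>m m - edge_mat m E ec a) $$ (i, i) = 1"
  by (auto simp: edge_mat_def intro!: upper_triangularI dest!: edgeD)

lemma concentration_inj:
  assumes "\<forall>s. 0 < w s"
    and "concentration m E vc ec a w = concentration m E vc ec b w"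
    and "(j, i) \<in> E"
  shows "a (ec (j, i)) = b (ec (j, i))"
proof -
  have "1\<^sub>m m - edge_mat m E ec a = 1\<^sub>m m - edge_mat m E ec b"
    using assms(1,2) unfolding concentration_def
    by (intro unit_upper_triangular_factor_unique[OF unit_edge_mat unit_edge_mat])
      (auto simp: less_imp_neq[symmetric])
  moreover have "i < m" "j < m" "i \<noteq> j"
    using edgeD[OF assms(3)] by auto
  ultimately have "(1\<^sub>m m - edge_mat m E ec a) $$ (i, j) = (1\<^sub>m m - edge_mat m E ec b) $$ (i, j)"
    by simp
  then show ?thesis using \<open>i < m\<close> \<open>j < m\<close> assms(3) by (simp add: edge_mat_def)
qed

lemma det_concentration:
  "det (concentration m E vc ec a w) = (\<Prod>i<m. 1 / w (vc i))"
proof -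
  let ?U = "1\<^sub>m m - edge_mat m E ec a" and ?D = "mat_diag m (\<lambda>i. 1 / w (vc i))"
  note U = unit_edge_mat[where a = a]
  have "diag_mat ?U = map (\<lambda>i. 1) [0..<m]"
    using U(1,3) unfolding diag_mat_def by (intro map_cong) auto
  then have detU: "det ?U = 1"
    using det_upper_triangular[OF U(2,1)] by (simp add: map_replicate_const)
  have "diag_mat ?D = map (\<lambda>i. 1 / w (vc i)) [0..<m]"
    unfolding diag_mat_def by (auto simp: mat_diag_def)
  moreover have "det ?D = prod_list (diag_mat ?D)"
    by (rule det_upper_triangular[of _ m]) (auto simp: mat_diag_def)
  ultimately have detD: "det ?D = (\<Prod>i<m. 1 / w (vc i))"
    by (simp add: prod.distinct_set_conv_list[symmetric] atLeast0LessThan)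
  have "det (transpose_mat ?U * ?D * ?U) = det ?U * det ?D * det ?U"
    using U(1) by (simp add: det_mult[of _ m] det_transpose[of _ m])
  then show ?thesis using detU detD by (simp add: concentration_def)
qed

end

lemma sum_quad_swap:
  fixes f :: "'i \<Rightarrow> 'j \<Rightarrow> 'k \<Rightarrow> 'l \<Rightarrow> 'a :: comm_monoid_add"
  shows "(\<Sum>i\<in>A. \<Sum>j\<in>B. \<Sum>k\<in>C. \<Sum>l\<in>D. f i j k l) = (\<Sum>k\<in>C. \<Sum>l\<in>D. \<Sum>i\<in>A. \<Sum>j\<in>B. f i j k l)"
proof -
  have "(\<Sum>i\<in>A. \<Sum>j\<in>B. \<Sum>k\<in>C. \<Sum>l\<in>D. f i j k l) = (\<Sum>i\<in>A. \<Sum>k\<in>C. \<Sum>j\<in>B. \<Sum>l\<in>D. f i j k l)"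
    by (intro sum.cong refl sum.swap)
  also have "\<dots> = (\<Sum>k\<in>C. \<Sum>i\<in>A. \<Sum>j\<in>B. \<Sum>l\<in>D. f i j k l)"
    by (rule sum.swap)
  also have "\<dots> = (\<Sum>k\<in>C. \<Sum>i\<in>A. \<Sum>l\<in>D. \<Sum>j\<in>B. f i j k l)"
    by (intro sum.cong refl sum.swap)
  also have "\<dots> = (\<Sum>k\<in>C. \<Sum>l\<in>D. \<Sum>i\<in>A. \<Sum>j\<in>B. f i j k l)"
    by (intro sum.cong refl sum.swap)
  finally show ?thesis .
qed

text \<open>Cyclic invariance of the trace turns \<open>tr (U\<^sup>T D U Y Y\<^sup>T)\<close> into a weighted sum of the squared row
  norms of \<open>U Y\<close>; on entries this is an interchange of sums.\<close>

lemma trace_quadratic_sample_cov: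
  assumes U: "U \<in> carrier_mat m m" and Y: "Y \<in> carrier_mat m n"
  shows "mat_trace (transpose_mat U * mat_diag m d * U * sample_cov Y)
    = (\<Sum>l<m. d l * (\<Sum>k<n. (\<Sum>i<m. U $$ (l, i) * Y $$ (i, k))\<^sup>2)) / real n"
proof -
  have P: "(transpose_mat U * mat_diag m d * U) $$ (i, j) = (\<Sum>l<m. U $$ (l, i) * d l * U $$ (l, j))"
    if "i < m" "j < m" for i j
    using U that by (simp add: mat_diag_mult_right[of _ m] scalar_prod_def atLeast0LessThan)
  have S: "sample_cov Y $$ (j, i) = (\<Sum>k<n. Y $$ (j, k) * Y $$ (i, k)) / real n"
    if "i < m" "j < m" for i j
    using Y that by (simp add: sample_cov_def scalar_prod_def atLeast0LessThan)
  have dims: "transpose_mat U * mat_diag m d * U \<in> carrier_mat m m" "sample_cov Y \<in> carrier_mat m m"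
    using U Y by (auto simp: sample_cov_def)
  have "mat_trace (A * B) = (\<Sum>i<m. \<Sum>j<m. A $$ (i, j) * B $$ (j, i))"
    if "A \<in> carrier_mat m m" "B \<in> carrier_mat m m" for A B :: "real mat"
    using that by (simp add: mat_trace_def scalar_prod_def atLeast0LessThan)
  then have "mat_trace (transpose_mat U * mat_diag m d * U * sample_cov Y)
      = (\<Sum>i<m. \<Sum>j<m. (transpose_mat U * mat_diag m d * U) $$ (i, j) * sample_cov Y $$ (j, i))"
    using dims by blast
  also have "\<dots> = (\<Sum>i<m. \<Sum>j<m. \<Sum>l<m. \<Sum>k<n.
      d l * ((U $$ (l, i) * Y $$ (i, k)) * (U $$ (l, j) * Y $$ (j, k)))) / real n"
    by (simp add: P S sum_product sum_divide_distrib mult_ac)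
  also have "(\<Sum>i<m. \<Sum>j<m. \<Sum>l<m. \<Sum>k<n.
      d l * ((U $$ (l, i) * Y $$ (i, k)) * (U $$ (l, j) * Y $$ (j, k))))
      = (\<Sum>l<m. d l * (\<Sum>k<n. (\<Sum>i<m. U $$ (l, i) * Y $$ (i, k))\<^sup>2))"
    by (subst sum_quad_swap) (simp only: power2_eq_square sum_product sum_distrib_left[symmetric])
  finally show ?thesis .
qed

section \<open>The likelihood as a sum over vertex colours\<close>

text \<open>A compatibly coloured DAG with an enumeration of each \<open>prc s\<close> and a sample matrix.\<close>

locale rdag_sample =
  fixes m n :: nat and E :: "(nat \<times> nat) set"
    and vc :: "nat \<Rightarrow> 'c" and ec :: "nat \<times> nat \<Rightarrow> 'c"
    and enum :: "'c \<Rightarrow> nat \<Rightarrow> 'c" and Y :: "real mat"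
  assumes dag: "ordered_dag m E"
    and compat: "compatible_colouring m E vc ec"
    and enum: "prc_enumeration m E vc ec enum"
    and n_pos: "1 \<le> n"
    and Y: "Y \<in> carrier_mat m n"
begin

abbreviation V :: "'c \<Rightarrow> nat set" where "V \<equiv> colour_vertices m vc"

abbreviation P :: "'c \<Rightarrow> 'c set" where "P \<equiv> prc E vc ec"

abbreviation M :: "'c \<Rightarrow> real mat" where "M \<equiv> augmented_sample_matrix m E vc ec enum Y"

text \<open>Entry \<open>k\<close> of the vector \<open>\<Sum>\<^sub>j \<lambda>\<^sub>i\<^sub>j Y\<^sup>(\<^sup>j\<^sup>)\<close>, which predicts the \<open>i\<close>th row of the sample from
  its parents when the edges of colour \<open>t\<close> have weight \<open>a t\<close>.\<close>

definition fit :: "('c \<Rightarrow> real) \<Rightarrow> nat \<Rightarrow> nat \<Rightarrow> real" where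
  "fit a i k = (\<Sum>j | (j, i) \<in> E. a (ec (j, i)) * Y $$ (j, k))"

text \<open>The residual sum of squares over the vertices of colour \<open>s\<close>.\<close>

definition rss :: "('c \<Rightarrow> real) \<Rightarrow> 'c \<Rightarrow> real" where
  "rss a s = (\<Sum>i\<in>V s. \<Sum>k<n. (Y $$ (i, k) - fit a i k)\<^sup>2)"

lemma finite_parents: "finite {j. (j, i) \<in> E}"
  by (rule finite_subset[of _ "{..<m}"]) (use dag in \<open>auto simp: ordered_dag_def\<close>)

lemma finite_E: "finite E"
  by (rule finite_subset[of _ "{..<m} \<times> {..<m}"]) (use dag in \<open>auto simp: ordered_dag_def\<close>)

lemma finite_V [simp]: "finite (V s)"
  by (simp add: colour_vertices_def)

lemma finite_P [simp]: "finite (P s)"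
  by (rule finite_subset[of _ "ec ` E"]) (auto simp: prc_def finite_E)

lemma alpha_pos: "s \<in> vc ` {..<m} \<Longrightarrow> 0 < alpha m vc s"
  by (auto simp: alpha_def card_gt_0_iff colour_vertices_def)

lemma rss_nonneg: "0 \<le> rss a s"
  by (simp add: rss_def sum_nonneg)

lemma rss_eq_0_iff: "rss a s = 0 \<longleftrightarrow> (\<forall>i\<in>V s. \<forall>k<n. Y $$ (i, k) = fit a i k)"
proof -
  have "rss a s = 0 \<longleftrightarrow> (\<forall>i\<in>V s. (\<Sum>k<n. (Y $$ (i, k) - fit a i k)\<^sup>2) = 0)"
    unfolding rss_def by (rule sum_nonneg_eq_0_iff) (auto intro: sum_nonneg)
  also have "\<dots> \<longleftrightarrow> (\<forall>i\<in>V s. \<forall>k\<in>{..<n}. (Y $$ (i, k) - fit a i k)\<^sup>2 = 0)"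
    by (intro ball_cong refl sum_nonneg_eq_0_iff) auto
  finally show ?thesis by (simp add: Ball_def)
qed

lemma fit_eq_sum_prc:
  assumes "i \<in> V s"
  shows "fit a i k = (\<Sum>t\<in>P s. a t * (\<Sum>j | (j, i) \<in> E \<and> ec (j, i) = t. Y $$ (j, k)))"
proof -
  have "(\<lambda>j. ec (j, i)) ` {j. (j, i) \<in> E} \<subseteq> P s"
    using assms by (auto simp: prc_def colour_vertices_def)
  then have "fit a i k
      = (\<Sum>t\<in>P s. \<Sum>j\<in>{j \<in> {j. (j, i) \<in> E}. ec (j, i) = t}. a (ec (j, i)) * Y $$ (j, k))"
    unfolding fit_def by (intro sum.group[symmetric] finite_parents finite_P)
  also have "\<dots> = (\<Sum>t\<in>P s. a t * (\<Sum>j | (j, i) \<in> E \<and> ec (j, i) = t. Y $$ (j, k)))"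
    by (simp add: sum_distrib_left)
  finally show ?thesis .
qed

lemma fit_cong:
  assumes "i \<in> V s" "\<And>t. t \<in> P s \<Longrightarrow> a t = b t"
  shows "fit a i k = fit b i k"
  using assms by (simp add: fit_eq_sum_prc)

lemma fit_add: "fit (\<lambda>t. a t + b t) i k = fit a i k + fit b i k"
  by (simp add: fit_def sum.distrib distrib_right)

lemma fit_diff: "fit (\<lambda>t. a t - b t) i k = fit a i k - fit b i k"
  by (simp add: fit_def sum_subtractf left_diff_distrib)

lemma fit_scale: "fit (\<lambda>t. c * a t) i k = c * fit a i k"
  by (simp add: fit_def sum_distrib_left mult_ac)

text \<open>By compatibility, an edge colour in \<open>P s\<close> occurs only on edges into vertices of colour \<open>s\<close>.\<close>

lemma P_vertex_colour:
  assumes "(j, i) \<in> E"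
  shows "ec (j, i) \<in> P s \<longleftrightarrow> vc i = s"
proof
  assume "ec (j, i) \<in> P s"
  then obtain l k where "(l, k) \<in> E" "vc k = s" "ec (j, i) = ec (l, k)"
    unfolding prc_def by blast
  then show "vc i = s" using compat assms unfolding compatible_colouring_def by blast
qed (use assms in \<open>auto simp: prc_def\<close>)

text \<open>Column \<open>q\<close> of the augmented sample matrix stands for the pair of the vertex of its block and the
  sample \<open>q mod n\<close>, and every such pair occurs.\<close>

lemma all_columns_iff:
  "(\<forall>q<alpha m vc s * n. Q (sorted_list_of_set (V s) ! (q div n)) (q mod n))
    \<longleftrightarrow> (\<forall>i\<in>V s. \<forall>k<n. Q i k)"
proof
  assume Q: "\<forall>q<alpha m vc s * n. Q (sorted_list_of_set (V s) ! (q div n)) (q mod n)"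
  show "\<forall>i\<in>V s. \<forall>k<n. Q i k"
  proof (intro ballI allI impI)
    fix i k assume i: "i \<in> V s" and k: "k < n"
    then obtain p where p: "p < alpha m vc s" "sorted_list_of_set (V s) ! p = i"
      by (metis alpha_def finite_V in_set_conv_nth length_sorted_list_of_set set_sorted_list_of_set)
    have "p * n + k < Suc p * n" using k by simp
    also have "\<dots> \<le> alpha m vc s * n" using p by (intro mult_le_mono1) simp
    finally show "Q i k" using Q[rule_format, of "p * n + k"] p k by simp
  qed
next
  assume Q: "\<forall>i\<in>V s. \<forall>k<n. Q i k"
  show "\<forall>q<alpha m vc s * n. Q (sorted_list_of_set (V s) ! (q div n)) (q mod n)"
  proof (intro allI impI)
    fix q assume "q < alpha m vc s * n"
    then have "q div n < length (sorted_list_of_set (V s))"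
      by (simp add: alpha_def less_mult_imp_div_less)
    then have "sorted_list_of_set (V s) ! (q div n) \<in> V s"
      using nth_mem[of "q div n" "sorted_list_of_set (V s)"] by simp
    then show "Q (sorted_list_of_set (V s) ! (q div n)) (q mod n)"
      using Q n_pos by simp
  qed
qed

lemma dim_M [simp]: "dim_row (M s) = beta E vc ec s + 1" "dim_col (M s) = alpha m vc s * n"
  using Y by (simp_all add: augmented_sample_matrix_def Let_def)

lemma M_top:
  "q < alpha m vc s * n \<Longrightarrow>
    M s $$ (0, q) = Y $$ (sorted_list_of_set (V s) ! (q div n), q mod n)"
  using Y by (simp add: augmented_sample_matrix_def Let_def)

lemma enum_bij: "s \<in> vc ` {..<m} \<Longrightarrow> bij_betw (enum s) {1..<beta E vc ec s + 1} (P s)"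
  using enum unfolding prc_enumeration_def
  by (simp only: Suc_eq_plus1[symmetric] atLeastLessThanSuc_atLeastAtMost)

lemma sum_lower_rows:
  assumes s: "s \<in> vc ` {..<m}" and q: "q < alpha m vc s * n"
    and c: "\<And>r. r \<in> {1..<beta E vc ec s + 1} \<Longrightarrow> c r = a (enum s r)"
  shows "(\<Sum>r = 1..<beta E vc ec s + 1. c r * M s $$ (r, q))
    = fit a (sorted_list_of_set (V s) ! (q div n)) (q mod n)"
proof -
  let ?i = "sorted_list_of_set (V s) ! (q div n)"
  have "q div n < length (sorted_list_of_set (V s))"
    using q by (simp add: alpha_def less_mult_imp_div_less)
  then have i: "?i \<in> V s" using nth_mem[of "q div n" "sorted_list_of_set (V s)"] by simp
  have "(\<Sum>r = 1..<beta E vc ec s + 1. c r * M s $$ (r, q))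
      = (\<Sum>r = 1..<beta E vc ec s + 1. a (enum s r)
          * (\<Sum>j | (j, ?i) \<in> E \<and> ec (j, ?i) = enum s r. Y $$ (j, q mod n)))"
    using q Y c by (intro sum.cong) (auto simp: augmented_sample_matrix_def Let_def)
  also have "\<dots> = fit a ?i (q mod n)"
    unfolding fit_eq_sum_prc[OF i] by (rule sum.reindex_bij_betw[OF enum_bij[OF s]])
  finally show ?thesis .
qed

text \<open>Coefficients of the lower rows are the same as values at the edge colours in \<open>P s\<close>.\<close>

lemma ex_coefficients:
  assumes "s \<in> vc ` {..<m}"
  shows "\<exists>a. \<forall>r\<in>{1..<beta E vc ec s + 1}. c r = a (enum s r)"
  using enum_bij[OF assms]
  by (intro exI[of _ "\<lambda>t. c (inv_into {1..<beta E vc ec s + 1} (enum s) t)"])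
    (simp add: bij_betw_inv_into_left)

lemma top_row_in_span_M:
  assumes s: "s \<in> vc ` {..<m}"
  shows "top_row_in_span (M s) \<longleftrightarrow> (\<exists>a. rss a s = 0)"
proof -
  have eq: "(\<forall>q<dim_col (M s). M s $$ (0, q) = (\<Sum>r = 1..<dim_row (M s). c r * M s $$ (r, q)))
      \<longleftrightarrow> rss a s = 0"
    if c: "\<forall>r\<in>{1..<beta E vc ec s + 1}. c r = a (enum s r)" for c a
  proof -
    have "(\<forall>q<dim_col (M s). M s $$ (0, q) = (\<Sum>r = 1..<dim_row (M s). c r * M s $$ (r, q)))
        \<longleftrightarrow> (\<forall>q<alpha m vc s * n. Y $$ (sorted_list_of_set (V s) ! (q div n), q mod n)
          = fit a (sorted_list_of_set (V s) ! (q div n)) (q mod n))"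
      using M_top sum_lower_rows[of s _ c a, OF s _ bspec[OF c]] by simp
    then show ?thesis
      unfolding rss_eq_0_iff all_columns_iff[where Q = "\<lambda>i k. Y $$ (i, k) = fit a i k"] .
  qed
  show ?thesis
    unfolding top_row_in_span_iff[of "M s", simplified dim_M, OF zero_less_Suc[unfolded Suc_eq_plus1]]
  proof
    assume "\<exists>c. \<forall>q<alpha m vc s * n. M s $$ (0, q)
      = (\<Sum>r = 1..<beta E vc ec s + 1. c r * M s $$ (r, q))"
    then obtain c where c: "\<forall>q<alpha m vc s * n. M s $$ (0, q)
      = (\<Sum>r = 1..<beta E vc ec s + 1. c r * M s $$ (r, q))" by blast
    obtain a where a: "\<forall>r\<in>{1..<beta E vc ec s + 1}. c r = a (enum s r)"
      using ex_coefficients[OF s] by blast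
    show "\<exists>a. rss a s = 0" using eq[OF a, unfolded dim_M] c by blast
  next
    assume "\<exists>a. rss a s = 0"
    then obtain a where a: "rss a s = 0" by blast
    show "\<exists>c. \<forall>q<alpha m vc s * n. M s $$ (0, q)
      = (\<Sum>r = 1..<beta E vc ec s + 1. c r * M s $$ (r, q))"
    proof
      show "\<forall>q<alpha m vc s * n. M s $$ (0, q)
        = (\<Sum>r = 1..<beta E vc ec s + 1. a (enum s r) * M s $$ (r, q))"
        by (rule iffD2[OF eq[unfolded dim_M] a]) simp
    qed
  qed
qed

lemma full_row_rank_M:
  assumes s: "s \<in> vc ` {..<m}"
  shows "full_row_rank (M s) \<longleftrightarrow>
    (\<forall>c0 a. (\<forall>i\<in>V s. \<forall>k<n. c0 * Y $$ (i, k) + fit a i k = 0) \<longrightarrow> c0 = 0 \<and> (\<forall>t\<in>P s. a t = 0))"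
    (is "_ \<longleftrightarrow> ?R")
proof -
  have split: "{..<beta E vc ec s + 1} = insert 0 {1..<beta E vc ec s + 1}" by auto
  have eq: "(\<forall>q<alpha m vc s * n. (\<Sum>r<beta E vc ec s + 1. c r * M s $$ (r, q)) = 0)
      \<longleftrightarrow> (\<forall>i\<in>V s. \<forall>k<n. c 0 * Y $$ (i, k) + fit a i k = 0)"
    if c: "\<forall>r\<in>{1..<beta E vc ec s + 1}. c r = a (enum s r)" for c a
  proof -
    have "(\<Sum>r<beta E vc ec s + 1. c r * M s $$ (r, q))
        = c 0 * Y $$ (sorted_list_of_set (V s) ! (q div n), q mod n)
          + fit a (sorted_list_of_set (V s) ! (q div n)) (q mod n)"
      if "q < alpha m vc s * n" for q
      using M_top[OF that] sum_lower_rows[of s q c a, OF s that bspec[OF c]] unfolding split by simp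
    then show ?thesis
      unfolding all_columns_iff[where Q = "\<lambda>i k. c 0 * Y $$ (i, k) + fit a i k = 0", symmetric]
      by simp
  qed
  have zero: "(\<forall>r<beta E vc ec s + 1. c r = 0) \<longleftrightarrow> c 0 = 0 \<and> (\<forall>t\<in>P s. a t = 0)"
    if c: "\<forall>r\<in>{1..<beta E vc ec s + 1}. c r = a (enum s r)" for c :: "nat \<Rightarrow> real" and a
  proof -
    have "P s = enum s ` {1..<beta E vc ec s + 1}"
      using enum_bij[OF s] by (simp add: bij_betw_def)
    then have "(\<forall>t\<in>P s. a t = 0) \<longleftrightarrow> (\<forall>r\<in>{1..<beta E vc ec s + 1}. c r = 0)"
      using c by simp
    moreover have "(\<forall>r<beta E vc ec s + 1. c r = 0) \<longleftrightarrow> (\<forall>r\<in>{..<beta E vc ec s + 1}. c r = 0)"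
      by auto
    ultimately show ?thesis unfolding split by simp
  qed
  have "full_row_rank (M s) \<longleftrightarrow>
      (\<forall>c. (\<forall>q<alpha m vc s * n. (\<Sum>r<beta E vc ec s + 1. c r * M s $$ (r, q)) = 0)
        \<longrightarrow> (\<forall>r<beta E vc ec s + 1. c r = 0))"
    unfolding full_row_rank_iff dim_M ..
  also have "\<dots> \<longleftrightarrow> ?R"
  proof
    assume full: "\<forall>c. (\<forall>q<alpha m vc s * n. (\<Sum>r<beta E vc ec s + 1. c r * M s $$ (r, q)) = 0)
        \<longrightarrow> (\<forall>r<beta E vc ec s + 1. c r = 0)"
    show ?R
    proof (intro allI impI)
      fix c0 a assume *: "\<forall>i\<in>V s. \<forall>k<n. c0 * Y $$ (i, k) + fit a i k = 0"
      define c where "c r = (if r = 0 then c0 else a (enum s r))" for r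
      have c: "\<forall>r\<in>{1..<beta E vc ec s + 1}. c r = a (enum s r)" and c0: "c 0 = c0"
        by (simp_all add: c_def)
      have "\<forall>q<alpha m vc s * n. (\<Sum>r<beta E vc ec s + 1. c r * M s $$ (r, q)) = 0"
        using * by (simp only: eq[OF c] c0)
      then have "\<forall>r<beta E vc ec s + 1. c r = 0" by (rule full[THEN spec, THEN mp])
      then show "c0 = 0 \<and> (\<forall>t\<in>P s. a t = 0)" unfolding zero[OF c] c0 .
    qed
  next
    assume R: ?R
    show "\<forall>c. (\<forall>q<alpha m vc s * n. (\<Sum>r<beta E vc ec s + 1. c r * M s $$ (r, q)) = 0)
        \<longrightarrow> (\<forall>r<beta E vc ec s + 1. c r = 0)"
    proof (intro allI impI)
      fix c :: "nat \<Rightarrow> real" and r :: nat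
      assume *: "\<forall>q<alpha m vc s * n. (\<Sum>r<beta E vc ec s + 1. c r * M s $$ (r, q)) = 0"
        and r: "r < beta E vc ec s + 1"
      obtain a where c: "\<forall>r\<in>{1..<beta E vc ec s + 1}. c r = a (enum s r)"
        using ex_coefficients[OF s] by blast
      show "c r = 0" using R eq[OF c] zero[OF c] * r by blast
    qed
  qed
  finally show ?thesis .
qed

text \<open>Full row rank splits into the condition for existence and linear independence of the lower
  rows, the condition for the least squares coefficients to be unique.\<close>

lemma full_row_rank_M_split:
  assumes s: "s \<in> vc ` {..<m}"
  shows "full_row_rank (M s) \<longleftrightarrow> \<not> top_row_in_span (M s) \<and>
    (\<forall>a. (\<forall>i\<in>V s. \<forall>k<n. fit a i k = 0) \<longrightarrow> (\<forall>t\<in>P s. a t = 0))"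
proof
  assume "full_row_rank (M s)"
  then have full: "\<And>c0 a. \<forall>i\<in>V s. \<forall>k<n. c0 * Y $$ (i, k) + fit a i k = 0 \<Longrightarrow>
      c0 = 0 \<and> (\<forall>t\<in>P s. a t = 0)"
    unfolding full_row_rank_M[OF s] by blast
  have "rss a s \<noteq> 0" for a
  proof
    assume "rss a s = 0"
    then have "\<forall>i\<in>V s. \<forall>k<n. - 1 * Y $$ (i, k) + fit a i k = 0" by (simp add: rss_eq_0_iff)
    from full[OF this] show False by simp
  qed
  moreover have "\<forall>t\<in>P s. a t = 0" if "\<forall>i\<in>V s. \<forall>k<n. fit a i k = 0" for a
    using full[of 0 a] that by simp
  ultimately show "\<not> top_row_in_span (M s) \<and>
      (\<forall>a. (\<forall>i\<in>V s. \<forall>k<n. fit a i k = 0) \<longrightarrow> (\<forall>t\<in>P s. a t = 0))"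
    unfolding top_row_in_span_M[OF s] by blast
next
  assume R: "\<not> top_row_in_span (M s) \<and>
    (\<forall>a. (\<forall>i\<in>V s. \<forall>k<n. fit a i k = 0) \<longrightarrow> (\<forall>t\<in>P s. a t = 0))"
  show "full_row_rank (M s)"
    unfolding full_row_rank_M[OF s]
  proof (intro allI impI)
    fix c0 a assume *: "\<forall>i\<in>V s. \<forall>k<n. c0 * Y $$ (i, k) + fit a i k = 0"
    have "c0 = 0"
    proof (rule ccontr)
      assume c0: "c0 \<noteq> 0"
      \<comment> \<open>Solving the relation for the top row puts it in the span of the others.\<close>
      have "Y $$ (i, k) = fit (\<lambda>t. - (1 / c0) * a t) i k" if "i \<in> V s" "k < n" for i k
      proof -
        have "c0 * Y $$ (i, k) = - fit a i k" using * that by (simp add: add_eq_0_iff2)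
        then show ?thesis using c0 unfolding fit_scale by (simp add: field_simps)
      qed
      then have "rss (\<lambda>t. - (1 / c0) * a t) s = 0" unfolding rss_eq_0_iff by blast
      then show False using R top_row_in_span_M[OF s] by blast
    qed
    moreover have "\<forall>t\<in>P s. a t = 0" using R * \<open>c0 = 0\<close> by simp
    ultimately show "c0 = 0 \<and> (\<forall>t\<in>P s. a t = 0)" ..
  qed
qed

lemma log_likelihood_concentration:
  assumes w: "\<forall>s. 0 < w s"
  shows "log_likelihood Y (concentration m E vc ec a w)
    = (\<Sum>s\<in>vc ` {..<m}. - real (alpha m vc s) * ln (w s) - rss a s / (real n * w s))"
proof -
  let ?U = "1\<^sub>m m - edge_mat m E ec a"
  let ?g = "\<lambda>l. - ln (w (vc l)) - (\<Sum>k<n. (Y $$ (l, k) - fit a l k)\<^sup>2) / (real n * w (vc l))"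
  have U: "?U \<in> carrier_mat m m" by (rule unit_edge_mat(1)[OF dag])
  have UY: "(\<Sum>i<m. ?U $$ (l, i) * Y $$ (i, k)) = Y $$ (l, k) - fit a l k" if "l < m" for l k
  proof -
    have "(\<Sum>i<m. ?U $$ (l, i) * Y $$ (i, k))
        = (\<Sum>i<m. (if i = l then Y $$ (i, k) else 0))
          - (\<Sum>i<m. (if (i, l) \<in> E then a (ec (i, l)) * Y $$ (i, k) else 0))"
      unfolding sum_subtractf[symmetric]
      using that by (intro sum.cong) (auto simp: edge_mat_def left_diff_distrib)
    also have "(\<Sum>i<m. (if (i, l) \<in> E then a (ec (i, l)) * Y $$ (i, k) else 0)) = fit a l k"
      unfolding fit_def using dag
      by (subst sum.inter_filter[symmetric]) (auto simp: ordered_dag_def intro!: sum.cong)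
    finally show ?thesis using that by simp
  qed
  have "ln (det (concentration m E vc ec a w)) = (\<Sum>l<m. - ln (w (vc l)))"
  proof -
    have "w s \<noteq> 0" for s using w[rule_format, of s] by simp
    then have "ln (\<Prod>l<m. 1 / w (vc l)) = (\<Sum>l<m. ln (1 / w (vc l)))"
      using w by (intro ln_prod) simp_all
    moreover have "ln (1 / w s) = - ln (w s)" for s
      using w[rule_format, of s] by (simp add: ln_div)
    ultimately show ?thesis unfolding det_concentration[OF dag] by (simp only:)
  qed
  moreover have "mat_trace (concentration m E vc ec a w * sample_cov Y)
      = (\<Sum>l<m. (\<Sum>k<n. (Y $$ (l, k) - fit a l k)\<^sup>2) / (real n * w (vc l)))"
    unfolding concentration_def trace_quadratic_sample_cov[OF U Y]
    by (simp add: UY) (simp add: sum_divide_distrib mult_ac)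
  ultimately have "log_likelihood Y (concentration m E vc ec a w) = (\<Sum>l<m. ?g l)"
    by (simp add: log_likelihood_def sum_subtractf)
  also have "\<dots> = (\<Sum>s\<in>vc ` {..<m}. \<Sum>l\<in>V s. ?g l)"
    by (subst sum.image_gen[where g = vc]) (auto simp: colour_vertices_def)
  also have "\<dots> = (\<Sum>s\<in>vc ` {..<m}. - real (alpha m vc s) * ln (w s) - rss a s / (real n * w s))"
  proof (intro sum.cong refl)
    fix s assume "s \<in> vc ` {..<m}"
    have "(\<Sum>l\<in>V s. ?g l) = (\<Sum>l\<in>V s. - ln (w s)
        - (\<Sum>k<n. (Y $$ (l, k) - fit a l k)\<^sup>2) / (real n * w s))"
      by (intro sum.cong) (auto simp: colour_vertices_def)
    then show "(\<Sum>l\<in>V s. ?g l) = - real (alpha m vc s) * ln (w s) - rss a s / (real n * w s)"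
      by (simp add: sum_subtractf alpha_def rss_def sum_divide_distrib)
  qed
  finally show ?thesis .
qed

section \<open>Maximum likelihood estimates\<close>

text \<open>Distinct vertex colours use disjoint sets of edge colours, so the least squares problems of
  the vertex colours can be solved by one and the same \<open>a\<close>.\<close>

lemma ex_least_squares:
  "\<exists>a. \<forall>s\<in>vc ` {..<m}. \<forall>b. (\<Sum>i\<in>V s. \<Sum>k<n. (Y $$ (i, k) - fit a i k) * fit b i k) = 0"
proof -
  define u where
    "u t q = (\<Sum>j | (j, fst q) \<in> E \<and> ec (j, fst q) = t. Y $$ (j, snd q))" for t q
  define r where "r s a q = Y $$ q - (\<Sum>t\<in>P s. a t * u t q)" for s a q
  have fit_u: "fit b i k = (\<Sum>t\<in>P s. b t * u t (i, k))" if "i \<in> V s" for b i k s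
    using fit_eq_sum_prc[OF that] by (simp add: u_def)
  have "\<exists>a. \<forall>t\<in>P s. (\<Sum>q\<in>V s \<times> {..<n}. r s a q * u t q) = 0" for s
    unfolding r_def by (rule normal_equations_solvable) simp_all
  then obtain A where A: "\<And>s. \<forall>t\<in>P s. (\<Sum>q\<in>V s \<times> {..<n}. r s (A s) q * u t q) = 0"
    using choice[of "\<lambda>s a. \<forall>t\<in>P s. (\<Sum>q\<in>V s \<times> {..<n}. r s a q * u t q) = 0"] by blast
  define pick where "pick t = (SOME e. e \<in> E \<and> ec e = t)" for t
  define a where "a t = A (vc (snd (pick t))) t" for t
  have a: "a t = A s t" if t: "t \<in> P s" for s t
  proof -
    obtain j i where "(j, i) \<in> E" "ec (j, i) = t" using t by (auto simp: prc_def)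
    then have pick: "pick t \<in> E" "ec (pick t) = t"
      using someI[of "\<lambda>e. e \<in> E \<and> ec e = t" "(j, i)"] by (auto simp: pick_def)
    obtain l k where "pick t = (l, k)" by fastforce
    then have "vc (snd (pick t)) = s"
      using pick t P_vertex_colour[of l k s] by simp
    then show ?thesis by (simp add: a_def)
  qed
  have "(\<Sum>i\<in>V s. \<Sum>k<n. (Y $$ (i, k) - fit a i k) * fit b i k) = 0" for s b
  proof -
    have "(Y $$ (i, k) - fit a i k) * fit b i k = (\<Sum>t\<in>P s. b t * (r s (A s) (i, k) * u t (i, k)))"
      if i: "i \<in> V s" for i k
    proof -
      have "Y $$ (i, k) - fit a i k = r s (A s) (i, k)"
        unfolding r_def fit_u[OF i] by (simp add: a)
      then show ?thesis unfolding fit_u[OF i, of b] by (simp add: sum_distrib_left mult_ac)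
    qed
    then have "(\<Sum>i\<in>V s. \<Sum>k<n. (Y $$ (i, k) - fit a i k) * fit b i k)
        = (\<Sum>i\<in>V s. \<Sum>k<n. \<Sum>t\<in>P s. b t * (r s (A s) (i, k) * u t (i, k)))"
      by simp
    also have "\<dots> = (\<Sum>q\<in>V s \<times> {..<n}. \<Sum>t\<in>P s. b t * (r s (A s) q * u t q))"
      by (subst sum.cartesian_product) (simp add: case_prod_beta)
    also have "\<dots> = (\<Sum>t\<in>P s. b t * (\<Sum>q\<in>V s \<times> {..<n}. r s (A s) q * u t q))"
      by (subst sum.swap) (simp only: sum_distrib_left)
    also have "\<dots> = 0" using A by simp
    finally show ?thesis .
  qed
  then show ?thesis by blast
qed

lemma rss_pythagoras:
  assumes orth: "\<And>b. (\<Sum>i\<in>V s. \<Sum>k<n. (Y $$ (i, k) - fit a i k) * fit b i k) = 0"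
  shows "rss b s = rss a s + (\<Sum>i\<in>V s. \<Sum>k<n. (fit (\<lambda>t. a t - b t) i k)\<^sup>2)"
proof -
  let ?d = "\<lambda>t. a t - b t"
  have "(Y $$ (i, k) - fit b i k)\<^sup>2 = (Y $$ (i, k) - fit a i k)\<^sup>2
      + (fit ?d i k)\<^sup>2 + 2 * ((Y $$ (i, k) - fit a i k) * fit ?d i k)" for i k
    unfolding fit_diff by (simp add: power2_eq_square algebra_simps)
  then have "rss b s = rss a s + (\<Sum>i\<in>V s. \<Sum>k<n. (fit ?d i k)\<^sup>2)
      + 2 * (\<Sum>i\<in>V s. \<Sum>k<n. (Y $$ (i, k) - fit a i k) * fit ?d i k)"
    unfolding rss_def by (simp only: sum.distrib sum_distrib_left)
  then show ?thesis using orth[of ?d] by simp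
qed

abbreviation model :: "real mat set" where "model \<equiv> rdag_model m E vc ec"

abbreviation conc :: "('c \<Rightarrow> real) \<Rightarrow> ('c \<Rightarrow> real) \<Rightarrow> real mat" where
  "conc \<equiv> concentration m E vc ec"

text \<open>The contribution of the vertex colour \<open>s\<close> to the log-likelihood.\<close>

definition score :: "('c \<Rightarrow> real) \<Rightarrow> ('c \<Rightarrow> real) \<Rightarrow> 'c \<Rightarrow> real" where
  "score a w s = - real (alpha m vc s) * ln (w s) - rss a s / (real n * w s)"

text \<open>The variance of colour \<open>s\<close> that maximises its contribution for given \<open>a\<close> with \<open>rss a s > 0\<close>. The value
  \<open>1\<close> at unused colours keeps it positive there, as the parametrisation of the model requires.\<close>

definition mle_var :: "('c \<Rightarrow> real) \<Rightarrow> 'c \<Rightarrow> real" where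
  "mle_var a s =
     (if s \<in> vc ` {..<m} then rss a s / (real n * real (alpha m vc s)) else 1)"

lemma log_likelihood_conc:
  "\<forall>s. 0 < w s \<Longrightarrow> log_likelihood Y (conc a w) = (\<Sum>s\<in>vc ` {..<m}. score a w s)"
  by (simp add: log_likelihood_concentration score_def)

lemma conc_in_model: "\<forall>s. 0 < w s \<Longrightarrow> conc a w \<in> model"
  using rdag_model_eq[OF dag, of vc ec] by blast

lemma in_modelE:
  assumes "Psi \<in> model"
  obtains a w where "\<forall>s. 0 < w s" "Psi = conc a w"
  using assms rdag_model_eq[OF dag, of vc ec] by blast

lemma conc_cong:
  assumes "\<And>t. t \<in> ec ` E \<Longrightarrow> a t = b t" "\<And>s. s \<in> vc ` {..<m} \<Longrightarrow> v s = w s"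
  shows "conc a v = conc b w"
proof -
  have "edge_mat m E ec a = edge_mat m E ec b"
    unfolding edge_mat_def using assms(1) by (intro cong_mat) auto
  moreover have "mat_diag m (\<lambda>i. 1 / v (vc i)) = mat_diag m (\<lambda>i. 1 / w (vc i))"
    unfolding mat_diag_def using assms(2) by (intro cong_mat) auto
  ultimately show ?thesis by (simp add: concentration_def)
qed

lemma unbounded_if_perfect_fit:
  assumes s: "s \<in> vc ` {..<m}" and a: "rss a s = 0"
  shows "\<not> bdd_above (log_likelihood Y ` model)"
proof
  assume "bdd_above (log_likelihood Y ` model)"
  then obtain B where B: "\<And>Psi. Psi \<in> model \<Longrightarrow> log_likelihood Y Psi \<le> B"
    by (auto simp: bdd_above_def)
  define C where "C = (\<Sum>s'\<in>vc ` {..<m} - {s}. score a (\<lambda>_. 1) s')"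
  \<comment> \<open>With all other variances equal to \<open>1\<close>, this \<open>\<epsilon>\<close> gives the log-likelihood \<open>B + 1\<close>.\<close>
  define \<epsilon> where "\<epsilon> = exp ((C - B - 1) / real (alpha m vc s))"
  define w where "w s' = (if s' = s then \<epsilon> else 1)" for s'
  have w: "\<forall>s. 0 < w s" by (simp add: w_def \<epsilon>_def)
  have "(\<Sum>s'\<in>vc ` {..<m} - {s}. score a w s') = C"
    unfolding C_def by (intro sum.cong) (auto simp: score_def w_def)
  moreover have "score a w s = - (C - B - 1)"
    using a alpha_pos[OF s] by (simp add: score_def w_def \<epsilon>_def)
  ultimately have "log_likelihood Y (conc a w) = B + 1"
    unfolding log_likelihood_conc[OF w] using s by (simp add: sum.remove)
  then show False using B[OF conc_in_model[OF w, of a]] by simp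
qed

text \<open>From here on, \<open>a\<close> solves the least squares problems of all colours, none with a perfect fit.\<close>

context
  fixes a :: "'c \<Rightarrow> real"
  assumes orth: "\<And>s b. s \<in> vc ` {..<m} \<Longrightarrow>
      (\<Sum>i\<in>V s. \<Sum>k<n. (Y $$ (i, k) - fit a i k) * fit b i k) = 0"
    and rss_pos: "\<And>s. s \<in> vc ` {..<m} \<Longrightarrow> 0 < rss a s"
begin

lemma mle_var_pos: "\<forall>s. 0 < mle_var a s"
  using rss_pos alpha_pos n_pos by (auto simp: mle_var_def)

lemma score_le:
  assumes s: "s \<in> vc ` {..<m}" and w: "\<forall>s. 0 < w s"
  shows "score b w s \<le> score a (mle_var a) s"
    and "score b w s = score a (mle_var a) s \<Longrightarrow> rss b s = rss a s \<and> w s = mle_var a s"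
proof -
  have le: "rss a s \<le> rss b s"
    unfolding rss_pythagoras[where s = s and a = a and b = b, OF orth[OF s]] by (simp add: sum_nonneg)
  have "mle_var a s = rss a s / (real n * real (alpha m vc s))" using s by (simp add: mle_var_def)
  note bound = scaled_log_bound[OF _ _ rss_pos[OF s] le w[rule_format, of s] this]
  show "score b w s \<le> score a (mle_var a) s"
    unfolding score_def using alpha_pos[OF s] n_pos by (intro bound(1)) simp_all
  show "rss b s = rss a s \<and> w s = mle_var a s" if "score b w s = score a (mle_var a) s"
    using that alpha_pos[OF s] n_pos unfolding score_def by (intro bound(2)) simp_all
qed

lemma is_MLE_mle: "is_MLE model Y (conc a (mle_var a))"
  unfolding is_MLE_def
proof (intro conjI ballI)
  show "conc a (mle_var a) \<in> model" by (rule conc_in_model[OF mle_var_pos])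
next
  fix Phi assume "Phi \<in> model"
  then obtain b w where w: "\<forall>s. 0 < w s" and Phi: "Phi = conc b w" by (rule in_modelE)
  show "log_likelihood Y Phi \<le> log_likelihood Y (conc a (mle_var a))"
    unfolding Phi log_likelihood_conc[OF w] log_likelihood_conc[OF mle_var_pos]
    by (intro sum_mono score_le(1) w)
qed

lemma is_MLE_imp:
  assumes mle: "is_MLE model Y (conc b w)" and w: "\<forall>s. 0 < w s" and s: "s \<in> vc ` {..<m}"
  shows "rss b s = rss a s" and "w s = mle_var a s"
proof -
  have "log_likelihood Y (conc a (mle_var a)) \<le> log_likelihood Y (conc b w)"
    using mle conc_in_model[OF mle_var_pos] by (simp add: is_MLE_def)
  moreover have "log_likelihood Y (conc b w) \<le> log_likelihood Y (conc a (mle_var a))"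
    using is_MLE_mle conc_in_model[OF w] by (simp add: is_MLE_def)
  ultimately have "(\<Sum>s\<in>vc ` {..<m}. score b w s) = (\<Sum>s\<in>vc ` {..<m}. score a (mle_var a) s)"
    unfolding log_likelihood_conc[OF w] log_likelihood_conc[OF mle_var_pos] by simp
  then have "score b w s = score a (mle_var a) s"
    by (rule sum_mono_inv) (use s score_le(1)[OF _ w] in auto)
  then show "rss b s = rss a s" "w s = mle_var a s" using score_le(2)[OF s w] by auto
qed

lemma unique_if_full_row_rank:
  assumes full: "\<And>s. s \<in> vc ` {..<m} \<Longrightarrow> full_row_rank (M s)"
    and mle: "is_MLE model Y Psi"
  shows "Psi = conc a (mle_var a)"
proof -
  obtain b w where w: "\<forall>s. 0 < w s" and Psi: "Psi = conc b w"
    using mle in_modelE unfolding is_MLE_def by blast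
  have eq: "b t = a t" if s: "s \<in> vc ` {..<m}" and t: "t \<in> P s" for s t
  proof -
    have "rss b s = rss a s" using is_MLE_imp(1)[OF _ w s] mle Psi by simp
    then have "(\<Sum>i\<in>V s. \<Sum>k<n. (fit (\<lambda>t. a t - b t) i k)\<^sup>2) = 0"
      using rss_pythagoras[where s = s and a = a and b = b, OF orth[OF s]] by simp
    then have "\<forall>i\<in>V s. (\<Sum>k<n. (fit (\<lambda>t. a t - b t) i k)\<^sup>2) = 0"
      by (subst (asm) sum_nonneg_eq_0_iff) (auto intro: sum_nonneg)
    then have "fit (\<lambda>t. a t - b t) i k = 0" if "i \<in> V s" "k < n" for i k
      using that by (subst (asm) sum_nonneg_eq_0_iff) auto
    then have "\<forall>t\<in>P s. a t - b t = 0"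
      using full[OF s] unfolding full_row_rank_M_split[OF s] by blast
    then show ?thesis using t by simp
  qed
  have "b t = a t" if t: "t \<in> ec ` E" for t
  proof -
    obtain p where "p \<in> E" "t = ec p" using t by blast
    then obtain j i where e: "(j, i) \<in> E" "t = ec (j, i)" by (cases p) simp
    have "i < m" using edgeD[OF dag e(1)] by simp
    then have "vc i \<in> vc ` {..<m}" by simp
    moreover have "t \<in> P (vc i)" using P_vertex_colour[OF e(1)] e(2) by simp
    ultimately show ?thesis by (rule eq)
  qed
  moreover have "w s = mle_var a s" if "s \<in> vc ` {..<m}" for s
    using is_MLE_imp(2)[OF _ w that] mle Psi by simp
  ultimately show ?thesis unfolding Psi by (intro conc_cong)
qed

lemma full_row_rank_if_unique:
  assumes unique: "\<And>Psi. is_MLE model Y Psi \<Longrightarrow> Psi = conc a (mle_var a)"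
    and s: "s \<in> vc ` {..<m}" and not_span: "\<not> top_row_in_span (M s)"
  shows "full_row_rank (M s)"
proof (rule ccontr)
  assume "\<not> full_row_rank (M s)"
  then obtain d t where d: "\<forall>i\<in>V s. \<forall>k<n. fit d i k = 0" and t: "t \<in> P s" "d t \<noteq> 0"
    using not_span unfolding full_row_rank_M_split[OF s] by blast
  \<comment> \<open>A relation among the lower rows of colour \<open>s\<close> only constrains \<open>d\<close> on \<open>P s\<close>.\<close>
  define d' where "d' t = (if t \<in> P s then d t else 0)" for t
  define b where "b t = a t + d' t" for t
  have fit_d': "fit d' i k = 0" if "i < m" "k < n" for i k
  proof (cases "vc i = s")
    case True
    then have i: "i \<in> V s" using that by (simp add: colour_vertices_def)
    have "fit d' i k = fit d i k" by (rule fit_cong[OF i]) (simp add: d'_def)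
    then show ?thesis using d i that by simp
  next
    case False
    then show ?thesis unfolding fit_def using P_vertex_colour[of _ i s]
      by (intro sum.neutral) (auto simp: d'_def)
  qed
  have "rss b s' = rss a s'" for s'
    unfolding rss_def b_def fit_add
    by (intro sum.cong refl) (simp add: fit_d' colour_vertices_def)
  then have "log_likelihood Y (conc b (mle_var a)) = log_likelihood Y (conc a (mle_var a))"
    by (simp add: log_likelihood_conc[OF mle_var_pos] score_def)
  then have "is_MLE model Y (conc b (mle_var a))"
    using is_MLE_mle conc_in_model[OF mle_var_pos] by (simp add: is_MLE_def)
  then have eq: "conc b (mle_var a) = conc a (mle_var a)" by (rule unique)
  obtain j i where e: "(j, i) \<in> E" "t = ec (j, i)" using t by (auto simp: prc_def)
  have "b t = a t" unfolding e(2) by (rule concentration_inj[OF dag mle_var_pos eq e(1)])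
  then show False using t by (simp add: b_def d'_def)
qed

end

lemma bdd_above_if_MLE:
  "is_MLE model Y Psi \<Longrightarrow> bdd_above (log_likelihood Y ` model)"
  by (auto simp: is_MLE_def bdd_above_def)

lemma MLE_characterisation:
  "(\<not> bdd_above (log_likelihood Y ` model) \<longleftrightarrow> (\<exists>s\<in>vc ` {..<m}. top_row_in_span (M s)))
    \<and> ((\<exists>Psi. is_MLE model Y Psi) \<longleftrightarrow> (\<forall>s\<in>vc ` {..<m}. \<not> top_row_in_span (M s)))
    \<and> ((\<exists>!Psi. is_MLE model Y Psi) \<longleftrightarrow> (\<forall>s\<in>vc ` {..<m}. full_row_rank (M s)))"
proof (cases "\<exists>s\<in>vc ` {..<m}. top_row_in_span (M s)")
  case True
  then have "\<not> bdd_above (log_likelihood Y ` model)"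
    using unbounded_if_perfect_fit by (metis top_row_in_span_M)
  moreover from this have "\<nexists>Psi. is_MLE model Y Psi" by (metis bdd_above_if_MLE)
  moreover have "\<exists>s\<in>vc ` {..<m}. \<not> full_row_rank (M s)"
    using True full_row_rank_M_split by blast
  ultimately show ?thesis using True by metis
next
  case False
  obtain a where orth: "\<And>s b. s \<in> vc ` {..<m} \<Longrightarrow>
      (\<Sum>i\<in>V s. \<Sum>k<n. (Y $$ (i, k) - fit a i k) * fit b i k) = 0"
    using ex_least_squares by blast
  have pos: "0 < rss a s" if "s \<in> vc ` {..<m}" for s
    using False that top_row_in_span_M[OF that] rss_nonneg[of a s] by (metis less_eq_real_def)
  note mle = is_MLE_mle[OF orth pos]
  have "(\<exists>!Psi. is_MLE model Y Psi) \<longleftrightarrow> (\<forall>s\<in>vc ` {..<m}. full_row_rank (M s))"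
  proof
    assume "\<exists>!Psi. is_MLE model Y Psi"
    then have "\<And>Psi. is_MLE model Y Psi \<Longrightarrow> Psi = conc a (mle_var a)" using mle by blast
    then show "\<forall>s\<in>vc ` {..<m}. full_row_rank (M s)"
      using full_row_rank_if_unique[OF orth pos] False by blast
  next
    assume "\<forall>s\<in>vc ` {..<m}. full_row_rank (M s)"
    then show "\<exists>!Psi. is_MLE model Y Psi"
      using mle unique_if_full_row_rank[OF orth pos] by blast
  qed
  then show ?thesis using False mle bdd_above_if_MLE[OF mle] by metis
qed

end

theorem theorem4p4:
  fixes m n :: nat and E :: "(nat \<times> nat) set"
    and vc :: "nat \<Rightarrow> 'c" and ec :: "nat \<times> nat \<Rightarrow> 'c"
    and enum :: "'c \<Rightarrow> nat \<Rightarrow> 'c" and Y :: "real mat"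
  assumes "ordered_dag m E"
    and "compatible_colouring m E vc ec"
    and "prc_enumeration m E vc ec enum"
    and "1 \<le> n"
    and "Y \<in> carrier_mat m n"
  shows "(\<not> bdd_above (log_likelihood Y ` rdag_model m E vc ec) \<longleftrightarrow>
            (\<exists>s \<in> vc ` {..<m}. top_row_in_span (augmented_sample_matrix m E vc ec enum Y s)))
       \<and> ((\<exists>Psi. is_MLE (rdag_model m E vc ec) Y Psi) \<longleftrightarrow>
            (\<forall>s \<in> vc ` {..<m}. \<not> top_row_in_span (augmented_sample_matrix m E vc ec enum Y s)))
       \<and> ((\<exists>!Psi. is_MLE (rdag_model m E vc ec) Y Psi) \<longleftrightarrow>
            (\<forall>s \<in> vc ` {..<m}. full_row_rank (augmented_sample_matrix m E vc ec enum Y s)))"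
proof -
  interpret rdag_sample m n E vc ec enum Y
    using assms by unfold_locales
  show ?thesis by (rule MLE_characterisation)
qed

end
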